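(* For any integer $n \ge 1$, there are exactly $(n-1)!$ extremely unlucky Stirling permutations of order $n$; that is, $|\{w \in Q_n : \mathrm{Lucky}(w) = \{1\}\}| = (n-1)!$.
   Context: A Stirling permutation of order $n$ is a permutation $w = w(1)w(2)\cdots w(2n)$ of the multiset $\{1,1,2,2,\ldots,n,n\}$ such that any value $j$ appearing between the two instances of $i$ satisfies $j>i$. $Q_n$ denotes the set of Stirling permutations of order $n$. Parking interpretation: there is a one-way street with spots $1,\ldots,2n$ (in this order), and cars $1,2,\ldots,2n$ arrive in order, car $i$ having preferred spot $w(i)$. Car $i$ parks in spot $w(i)$ if it is available; otherwise it continues down the street and parks in the first available spot after $w(i)$. For every $w\in Q_n$ all cars park. Car $i$ is lucky if it parks in its preferred spot $w(i)$, and unlucky otherwise. $\mathrm{Lucky}(w)\subseteq\{1,\ldots,2n\}$ denotes the set of lucky cars (car indices) of $w$. A Stirling permutation $w$ is extremely unlucky if $\mathrm{Lucky}(w)=\{1\}$. *)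

theory Defs
  imports Complex_Main "HOL-Library.Multiset"
begin

text \<open>
  A word \<open>w(1) \<dots> w(2n)\<close> is a list of naturals; Isabelle lists are indexed from 0, so
  \<open>w(i)\<close> is \<open>w ! (i - 1)\<close>. Values, cars and parking spots are all numbered from 1.
\<close>

definition stirling_perms :: "nat \<Rightarrow> nat list set" where
  "stirling_perms n = {w. mset w = mset_set {1..n} + mset_set {1..n} \<and>
     (\<forall>a b c. a < b \<and> b < c \<and> c < length w \<and> w ! a = w ! c \<longrightarrow> w ! b > w ! a)}"

text \<open>
  The street has spots \<open>1, \<dots>, m\<close>, of which those in \<open>occ\<close> are occupied. The result is the spot
  taken by an arriving car that prefers spot \<open>p\<close>, or \<open>None\<close> if the car leaves the street unparked.
\<close>

definition park_car :: "nat \<Rightarrow> nat set \<Rightarrow> nat \<Rightarrow> nat option" where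
  "park_car m occ p =
     (if \<exists>s \<in> {p..m}. s \<notin> occ then Some (LEAST s. s \<in> {p..m} \<and> s \<notin> occ) else None)"

primrec park_all :: "nat \<Rightarrow> nat set \<Rightarrow> nat list \<Rightarrow> nat option list" where
  "park_all m occ [] = []"
| "park_all m occ (p # ps) =
     (let r = park_car m occ p in r # park_all m (occ \<union> set_option r) ps)"

definition parking_outcome :: "nat list \<Rightarrow> nat option list" where
  "parking_outcome w = park_all (length w) {} w"

definition lucky :: "nat list \<Rightarrow> nat set" where
  "lucky w = {i \<in> {1..length w}. parking_outcome w ! (i - 1) = Some (w ! (i - 1))}"

definition extremely_unlucky :: "nat list \<Rightarrow> bool" where
  "extremely_unlucky w \<longleftrightarrow> lucky w = {1}"

end

theory Submission
  imports Defs "HOL-Library.Sublist"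
begin

text \<open>
  The cars parked so far always occupy an initial segment of the street, so \<open>w\<close> is extremely
  unlucky iff \<open>w(1) = 1\<close> and \<open>w(i) < i\<close> for \<open>i \<ge> 2\<close>. The two copies of the largest value \<open>n + 1\<close>
  in a Stirling permutation of order \<open>n + 1\<close> are adjacent. Deleting them preserves the
  inequalities, since every entry moved is at most \<open>n\<close> and ends up beyond position \<open>n\<close>; inserting
  them is allowed at exactly \<open>n\<close> places. Hence the count is multiplied by \<open>n\<close> when passing from
  \<open>n\<close> to \<open>n + 1\<close>.
\<close>

section \<open>Parking\<close>

lemma park_car_free:
  assumes "p \<le> m" "p \<notin> occ"
  shows "park_car m occ p = Some p"
proof -
  have "(LEAST s. s \<in> {p..m} \<and> s \<notin> occ) = p"
    by (rule Least_equality) (use assms in auto)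
  then show ?thesis
    using assms by (auto simp: park_car_def)
qed

lemma park_car_initial_segment:
  assumes "p \<ge> 1" "p \<le> k" "k < m"
  shows "park_car m {1..k} p = Some (Suc k)"
proof -
  have "(LEAST s. s \<in> {p..m} \<and> s \<notin> {1..k}) = Suc k"
    by (rule Least_equality) (use assms in auto)
  moreover have "\<exists>s\<in>{p..m}. s \<notin> {1..k}"
    using assms by (intro bexI[of _ "Suc k"]) auto
  ultimately show ?thesis
    by (simp add: park_car_def)
qed

lemma park_car_SomeD:
  assumes "park_car m occ p = Some s"
  shows "p \<le> s"
proof -
  have ex: "\<exists>s. s \<in> {p..m} \<and> s \<notin> occ" and s: "s = (LEAST s. s \<in> {p..m} \<and> s \<notin> occ)"
    using assms by (auto simp: park_car_def split: if_splits)
  from LeastI_ex[OF ex] show ?thesis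
    by (simp add: s)
qed

text \<open>While spots \<open>1..k\<close> are taken, a preference at most \<open>k\<close> sends
  the car to spot \<open>k + 1\<close> and lengthens the segment, so the induction varies
  \<open>k\<close>. A preference above \<open>k\<close> is met at once, and both sides fail at index
  0. The equation \<open>k + length ps = m\<close> keeps spot \<open>k + 1\<close> on the
  street.\<close>

lemma park_all_unlucky_iff:
  assumes "k + length ps = m" "\<forall>p\<in>set ps. 1 \<le> p \<and> p \<le> m"
  shows "(\<forall>i<length ps. park_all m {1..k} ps ! i \<noteq> Some (ps ! i))
    \<longleftrightarrow> (\<forall>i<length ps. ps ! i \<le> k + i)"
  using assms
proof (induction ps arbitrary: k)
  case Nil
  then show ?case by simp
next
  case (Cons p ps)
  show ?case
  proof (cases "p \<le> k")
    case True
    have "park_car m {1..k} p = Some (Suc k)"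
      by (rule park_car_initial_segment) (use True Cons.prems in auto)
    moreover have "{1..k} \<union> {Suc k} = {1..Suc k}"
      by auto
    ultimately show ?thesis
      using Cons.IH[of "Suc k"] Cons.prems True
      by (simp add: Let_def All_less_Suc2)
  next
    case False
    then have "park_car m {1..k} p = Some p"
      using Cons.prems by (intro park_car_free) auto
    with False show ?thesis
      by (auto simp: Let_def All_less_Suc2)
  qed
qed

text \<open>No car parks before its preferred spot, so spot 1 stays free until the first car that
  prefers it arrives.\<close>

lemma park_all_spot_1_lucky:
  assumes "1 \<in> set ps" "0 \<notin> set ps" "1 \<notin> occ" "m \<ge> 1"
  shows "\<exists>i<length ps. park_all m occ ps ! i = Some (ps ! i)"
  using assms
proof (induction ps arbitrary: occ)
  case Nil
  then show ?case by simp
next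
  case (Cons p ps)
  show ?case
  proof (cases "p = 1")
    case True
    then have "park_car m occ p = Some p"
      using Cons.prems by (intro park_car_free) auto
    then show ?thesis
      by (intro exI[of _ 0]) (simp add: Let_def)
  next
    case False
    let ?occ = "occ \<union> set_option (park_car m occ p)"
    have "1 \<notin> ?occ"
      \<comment> \<open>Here \<open>p\<close> is neither 0 nor 1, so a car that parks takes spot 2
        or a later one.\<close>
      using park_car_SomeD[of m occ p 1] False Cons.prems by (cases p) auto
    then obtain i where "i < length ps" "park_all m ?occ ps ! i = Some (ps ! i)"
      using Cons.IH[of ?occ] Cons.prems False by auto
    then show ?thesis
      by (intro exI[of _ "Suc i"]) (simp add: Let_def)
  qed
qed

lemma lucky_eq_1_iff:
  "lucky (p # ps) = {1} \<longleftrightarrow> parking_outcome (p # ps) ! 0 = Some p \<and>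
     (\<forall>i<length ps. parking_outcome (p # ps) ! Suc i \<noteq> Some (ps ! i))"
    (is "?L \<longleftrightarrow> ?R")
proof
  assume L: ?L
  then have "1 \<in> lucky (p # ps)" by simp
  \<comment> \<open>Cars are numbered from 1 and lists from 0, so \<open>ps ! i\<close> belongs to
    car \<open>i + 2\<close>.\<close>
  moreover have "Suc (Suc i) \<notin> lucky (p # ps)" for i
    using L by simp
  ultimately show ?R
    by (auto simp: lucky_def)
next
  assume R: ?R
  have "i \<in> lucky (p # ps) \<longleftrightarrow> i = 1" for i
  proof (cases i)
    case (Suc j)
    then show ?thesis
      using R by (cases j) (auto simp: lucky_def)
  qed (simp add: lucky_def)
  then show ?L by auto
qed

text \<open>Index \<open>i\<close> belongs to car \<open>i + 1\<close>. If the \<open>i\<close> cars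
  before it fill spots \<open>1..i\<close>, it is unlucky exactly when
  \<open>w ! i \<le> i\<close>.\<close>

lemma extremely_unlucky_iff:
  assumes "1 \<in> set w" "\<forall>p\<in>set w. 1 \<le> p \<and> p \<le> length w"
  shows "extremely_unlucky w \<longleftrightarrow> w ! 0 = 1 \<and> (\<forall>i\<in>{1..<length w}. w ! i \<le> i)"
proof (cases w)
  case Nil
  with assms show ?thesis by simp
next
  case (Cons p ps)
  let ?m = "length w"
  have first: "park_car ?m {} p = Some p"
    using assms Cons by (intro park_car_free) auto
  \<comment> \<open>Car 1 meets an empty street and is lucky, so only the later cars matter, with
    \<open>p\<close> already occupied.\<close>
  have eq: "extremely_unlucky w \<longleftrightarrow>
      (\<forall>i<length ps. park_all ?m {p} ps ! i \<noteq> Some (ps ! i))"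
    using first Cons
    by (simp add: extremely_unlucky_def lucky_eq_1_iff parking_outcome_def Let_def del: One_nat_def)
  show ?thesis
  proof (cases "p = 1")
    case True
    have "(\<forall>i<length ps. park_all ?m {1..1} ps ! i \<noteq> Some (ps ! i))
        \<longleftrightarrow> (\<forall>i<length ps. ps ! i \<le> 1 + i)"
      using assms Cons by (intro park_all_unlucky_iff) auto
    also have "\<dots> \<longleftrightarrow> (\<forall>i\<in>{1..<length w}. w ! i \<le> i)"
    proof safe
      fix i assume *: "\<forall>i<length ps. ps ! i \<le> 1 + i" "i \<in> {1..<length w}"
      then show "w ! i \<le> i"
        by (cases i) (auto simp: Cons)
    next
      fix i assume *: "\<forall>i\<in>{1..<length w}. w ! i \<le> i" "i < length ps"
      from *(2) show "ps ! i \<le> 1 + i"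
        using bspec[OF *(1), of "Suc i"] by (simp add: Cons)
    qed
    finally show ?thesis
      using eq True Cons by simp
  next
    case False
    \<comment> \<open>Spot 1 is free and preferred by a later car, so some later car is lucky and
      both sides fail.\<close>
    have "\<exists>i<length ps. park_all ?m {p} ps ! i = Some (ps ! i)"
      by (rule park_all_spot_1_lucky) (use assms Cons False in auto)
    then show ?thesis
      using eq False Cons by auto
  qed
qed

section \<open>Stirling permutations\<close>

lemma subseq_Cons_iff_nth:
  "subseq (x # xs) ys \<longleftrightarrow> (\<exists>a<length ys. ys ! a = x \<and> subseq xs (drop (Suc a) ys))"
proof
  assume "subseq (x # xs) ys"
  then obtain us vs where "ys = us @ x # vs" "subseq xs vs"
    by (auto dest: list_emb_ConsD)
  then show "\<exists>a<length ys. ys ! a = x \<and> subseq xs (drop (Suc a) ys)"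
    by (intro exI[of _ "length us"]) auto
next
  assume "\<exists>a<length ys. ys ! a = x \<and> subseq xs (drop (Suc a) ys)"
  then obtain a where a: "a < length ys" "ys ! a = x" "subseq xs (drop (Suc a) ys)"
    by blast
  then have "subseq (x # xs) (take a ys @ x # drop (Suc a) ys)"
    by (intro list_emb_append2) auto
  then show "subseq (x # xs) ys"
    using a id_take_nth_drop[of a ys] by simp
qed

lemma subseq_triple_iff_nth:
  "subseq [x, y, z] w \<longleftrightarrow>
     (\<exists>a b c. a < b \<and> b < c \<and> c < length w \<and> w ! a = x \<and> w ! b = y \<and> w ! c = z)"
    (is "?L \<longleftrightarrow> ?R")
proof
  assume ?L
  then obtain a i j where "a < length w" "w ! a = x"
    "i < length (drop (Suc a) w)" "drop (Suc a) w ! i = y"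
    "j < length (drop (Suc i) (drop (Suc a) w))" "drop (Suc i) (drop (Suc a) w) ! j = z"
    unfolding subseq_Cons_iff_nth by blast
  \<comment> \<open>Each \<open>drop\<close> shifts the indices, so the relative positions
    \<open>i\<close> and \<open>j\<close> are turned back into absolute ones.\<close>
  then show ?R
    by (intro exI[of _ a] exI[of _ "Suc a + i"] exI[of _ "Suc a + (Suc i + j)"])
      (auto simp: ac_simps)
next
  assume ?R
  then obtain a b c where *: "a < b" "b < c" "c < length w" "w ! a = x" "w ! b = y" "w ! c = z"
    by blast
  show ?L
    unfolding subseq_Cons_iff_nth
    by (intro exI[of _ a] exI[of _ "b - Suc a"] exI[of _ "c - Suc b"] conjI) (use * in auto)
qed

text \<open>As avoidance of a pattern, the condition passes to all subsequences, and occurrences can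
  be followed through \<open>filter\<close>.\<close>

lemma stirling_perms_iff:
  "w \<in> stirling_perms n \<longleftrightarrow> mset w = mset_set {1..n} + mset_set {1..n} \<and>
     (\<forall>x y. subseq [x, y, x] w \<longrightarrow> x < y)"
proof -
  have "(\<forall>a b c. a < b \<and> b < c \<and> c < length w \<and> w ! a = w ! c \<longrightarrow> w ! b > w ! a) \<longleftrightarrow>
      (\<forall>x y. subseq [x, y, x] w \<longrightarrow> x < y)"
    unfolding subseq_triple_iff_nth by metis
  then show ?thesis
    by (simp add: stirling_perms_def)
qed

lemma stirling_perms_set:
  assumes "w \<in> stirling_perms n"
  shows "set w = {1..n}"
proof -
  have "set_mset (mset w) = {1..n}"
    using assms by (simp add: stirling_perms_iff)
  then show ?thesis by simp
qed

lemma stirling_perms_length: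
  assumes "w \<in> stirling_perms n"
  shows "length w = 2 * n"
proof -
  have "size (mset w) = 2 * n"
    using assms by (simp add: stirling_perms_iff)
  then show ?thesis by simp
qed

section \<open>Inserting and deleting the largest value\<close>

lemma subseq_set_subset: "subseq xs ys \<Longrightarrow> set xs \<subseteq> set ys"
  by (induction rule: list_emb.induct) auto

text \<open>The first letter of the pattern is matched no earlier than the left displayed
  \<open>N\<close>. Since \<open>y\<close> cannot be matched with the right one, \<open>y\<close>
  and the last \<open>N\<close> fall into \<open>zs\<close>.\<close>

lemma subseq_adjacent_pair:
  assumes "N \<notin> set xs" "subseq [N, y, N] (xs @ N # N # zs)" "y \<noteq> N"
  shows "N \<in> set zs"
  using assms
proof (induction xs)
  case Nil
  then have "subseq [y, N] zs"
    by simp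
  from subseq_set_subset[OF this] show ?case by simp
next
  case (Cons x xs)
  then show ?case
    by (auto simp: subseq_Cons2_iff)
qed

lemma mset_set_Suc_atLeast1: "mset_set {1..Suc n} = add_mset (Suc n) (mset_set {1..n})"
  by (simp add: atLeastAtMostSuc_conv)

text \<open>Deletion yields a subsequence. For insertion, \<open>Suc n\<close> may stand between any
  two equal smaller letters, and nothing stands between its own two copies.\<close>

lemma stirling_perms_insert_iff:
  "xs @ Suc n # Suc n # zs \<in> stirling_perms (Suc n) \<longleftrightarrow> xs @ zs \<in> stirling_perms n"
    (is "?w \<in> _ \<longleftrightarrow> _")
proof
  assume w: "?w \<in> stirling_perms (Suc n)"
  have "subseq (xs @ zs) ?w"
    by (intro list_emb_append_mono) auto
  then have "\<forall>x y. subseq [x, y, x] (xs @ zs) \<longrightarrow> x < y"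
    using w subseq_order.trans unfolding stirling_perms_iff by blast
  with w show "xs @ zs \<in> stirling_perms n"
    unfolding stirling_perms_iff mset_set_Suc_atLeast1 by simp
next
  assume w: "xs @ zs \<in> stirling_perms n"
  have set: "set xs \<union> set zs = {1..n}"
    using stirling_perms_set[OF w] by simp
  have "Suc n \<notin> set xs \<union> set zs"
    unfolding set by simp
  then have notin: "Suc n \<notin> set xs" "Suc n \<notin> set zs"
    by auto
  have "x < y" if sub: "subseq [x, y, x] ?w" for x y
  proof (rule ccontr)
    assume nless: "\<not> x < y"
    have "x \<in> set ?w"
      using subseq_set_subset[OF sub] by simp
    then have "x \<in> insert (Suc n) {1..n}"
      unfolding set[symmetric] by simp
    then have "x \<le> Suc n"
      by auto
    show False
    proof (cases "x = Suc n")
      case True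
      have "y = Suc n"
        using subseq_adjacent_pair[of "Suc n" xs y zs] sub notin True by auto
      \<comment> \<open>The pattern now consists of three copies of \<open>Suc n\<close>, but the
        word has only two.\<close>
      with True sub have "count_list [x, y, x] (Suc n) \<le> count_list ?w (Suc n)"
        using list_emb_length[OF subseq_filter[OF sub, of "\<lambda>z. Suc n = z"]]
        by (simp add: count_list_eq_length_filter)
      moreover have "count_list ?w (Suc n) = 2"
        using notin by (simp add: count_list_0_iff)
      ultimately show False
        using True \<open>y = Suc n\<close> by simp
    next
      case False
      \<comment> \<open>Both letters are at most \<open>n\<close>, so erasing \<open>Suc n\<close>
        keeps the pattern and carries it into \<open>xs @ zs\<close>.\<close>
      then have "x \<noteq> Suc n" "y \<noteq> Suc n"
        using nless \<open>x \<le> Suc n\<close> by auto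
      moreover have "filter (\<lambda>z. z \<noteq> Suc n) xs = xs" "filter (\<lambda>z. z \<noteq> Suc n) zs = zs"
        using notin by (auto intro!: filter_True)
      ultimately have "subseq [x, y, x] (xs @ zs)"
        using subseq_filter[OF sub, of "\<lambda>z. z \<noteq> Suc n"] by simp
      with w nless show False
        unfolding stirling_perms_iff by blast
    qed
  qed
  with w show "?w \<in> stirling_perms (Suc n)"
    unfolding stirling_perms_iff mset_set_Suc_atLeast1 by simp
qed

text \<open>A letter between the two copies of the largest value would have to exceed it.\<close>

lemma stirling_perms_Suc_split:
  assumes w: "w \<in> stirling_perms (Suc n)"
  obtains xs zs where "w = xs @ Suc n # Suc n # zs"
proof -
  have "Suc n \<in> set w"
    using stirling_perms_set[OF w] by simp
  then obtain xs ys where w1: "w = xs @ Suc n # ys" "Suc n \<notin> set xs"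
    by (meson split_list_first)
  have "count (mset w) (Suc n) = 2"
    using w by (simp add: stirling_perms_iff)
  moreover have "count (mset xs) (Suc n) = 0"
    using w1 by (simp add: count_eq_zero_iff)
  ultimately have "count (mset ys) (Suc n) = 1"
    using w1 by simp
  then have "Suc n \<in> set ys"
    by (metis count_eq_zero_iff set_mset_mset zero_neq_one)
  then obtain us zs where ys: "ys = us @ Suc n # zs"
    by (meson split_list)
  have "us = []"
  proof (cases us)
    case (Cons u us')
    have "subseq [Suc n, u, Suc n] w"
      unfolding w1 ys Cons by (simp add: list_emb_append2)
    then have "Suc n < u"
      using w by (auto simp: stirling_perms_iff)
    moreover have "u \<in> {1..Suc n}"
      using stirling_perms_set[OF w] w1 ys Cons by auto
    ultimately show ?thesis by simp
  qed
  with w1 ys that show thesis by simp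
qed

section \<open>Counting\<close>

definition unlucky_stirling_perms :: "nat \<Rightarrow> nat list set" where
  "unlucky_stirling_perms n =
     {w \<in> stirling_perms n. w ! 0 = 1 \<and> (\<forall>i\<in>{1..<2 * n}. w ! i \<le> i)}"

lemma unlucky_stirling_perms_eq:
  assumes "n \<ge> 1"
  shows "{w \<in> stirling_perms n. extremely_unlucky w} = unlucky_stirling_perms n"
proof -
  have "extremely_unlucky w \<longleftrightarrow> w ! 0 = 1 \<and> (\<forall>i\<in>{1..<2 * n}. w ! i \<le> i)"
    if "w \<in> stirling_perms n" for w
    using extremely_unlucky_iff[of w] stirling_perms_set[OF that] stirling_perms_length[OF that]
      assms by auto
  then show ?thesis
    unfolding unlucky_stirling_perms_def by blast
qed

text \<open>The left copy of \<open>Suc n\<close> has index \<open>length xs\<close>, so its own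
  bound is the condition on the length. Entries of \<open>xs\<close> keep their index.\<close>

lemma unlucky_stirling_perms_insert_iff:
  assumes "n \<ge> 1"
  shows "xs @ Suc n # Suc n # zs \<in> unlucky_stirling_perms (Suc n) \<longleftrightarrow>
    xs @ zs \<in> unlucky_stirling_perms n \<and> length xs \<ge> Suc n"
    (is "?w \<in> _ \<longleftrightarrow> ?v \<in> _ \<and> _")
proof (cases "?v \<in> stirling_perms n")
  case False
  then show ?thesis
    by (simp add: unlucky_stirling_perms_def stirling_perms_insert_iff)
next
  case v: True
  have len: "length xs + length zs = 2 * n"
    using stirling_perms_length[OF v] by simp
  \<comment> \<open>Once \<open>length xs\<close> exceeds \<open>n\<close>, entries of
    \<open>zs\<close> have index above \<open>n\<close> with or without the pair, so their bounds
    hold automatically.\<close>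
  have le: "zs ! i \<le> n" if "i < length zs" for i
    using stirling_perms_set[OF v] nth_mem[OF that] by auto
  have *: "?w ! 0 = ?v ! 0 \<and> ((\<forall>i\<in>{1..<2 * Suc n}. ?w ! i \<le> i) \<longleftrightarrow> (\<forall>i\<in>{1..<2 * n}. ?v ! i \<le> i))"
    if l: "length xs \<ge> Suc n"
  proof (intro conjI iffI ballI)
    show "?w ! 0 = ?v ! 0"
      using l by (auto simp: nth_append)
  next
    fix i assume w: "\<forall>i\<in>{1..<2 * Suc n}. ?w ! i \<le> i" and i: "i \<in> {1..<2 * n}"
    show "?v ! i \<le> i"
    proof (cases "i < length xs")
      case True
      then show ?thesis
        using bspec[OF w, of i] i by (simp add: nth_append)
    next
      case False
      then have "i - length xs < length zs" "n \<le> i"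
        using i l len by auto
      then show ?thesis
        using le[of "i - length xs"] False by (simp add: nth_append)
    qed
  next
    fix i assume v: "\<forall>i\<in>{1..<2 * n}. ?v ! i \<le> i" and i: "i \<in> {1..<2 * Suc n}"
    consider "i < length xs" | "i = length xs" | "i = Suc (length xs)" | "i \<ge> Suc (Suc (length xs))"
      by linarith
    then show "?w ! i \<le> i"
    proof cases
      case 1
      then show ?thesis
        using bspec[OF v, of i] i len by (simp add: nth_append)
    next
      case 4
      then obtain j where j: "i = length xs + Suc (Suc j)"
        using le_Suc_ex[OF 4] by auto
      then show ?thesis
        using le[of j] i l len by (simp add: nth_append)
    qed (use l in \<open>auto simp: nth_append\<close>)
  qed
  \<comment> \<open>An empty \<open>xs\<close> would make the first entry \<open>Suc n\<close>,
    which is not 1; otherwise the bound at index \<open>length xs\<close> applies.\<close>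
  have "length xs \<ge> Suc n" if w: "?w ! 0 = 1" "\<forall>i\<in>{1..<2 * Suc n}. ?w ! i \<le> i"
  proof (cases "xs = []")
    case True
    then show ?thesis using w(1) assms by simp
  next
    case False
    then show ?thesis
      using bspec[OF w(2), of "length xs"] len by (cases xs) auto
  qed
  with * v show ?thesis
    by (auto simp: unlucky_stirling_perms_def stirling_perms_insert_iff)
qed

lemma card_unlucky_stirling_perms_Suc:
  assumes "n \<ge> 1"
  shows "card (unlucky_stirling_perms (Suc n)) = n * card (unlucky_stirling_perms n)"
proof -
  define ins where "ins = (\<lambda>(w, p). take p w @ Suc n # Suc n # drop p w)"
  \<comment> \<open>The pair may follow \<open>p\<close> letters: \<open>p \<ge> n + 1\<close> by
    the bound on its left copy, \<open>p \<le> 2 * n\<close> by the length of the word. This leaves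
    \<open>n\<close> choices.\<close>
  let ?A = "unlucky_stirling_perms n \<times> {Suc n..2 * n}"
  have "bij_betw ins ?A (unlucky_stirling_perms (Suc n))"
  proof (rule bij_betw_imageI)
    \<comment> \<open>Since \<open>w\<close> lacks \<open>Suc n\<close>, erasing that value returns
      the word, and the prefix before its first occurrence returns \<open>p\<close>.\<close>
    have recover: "filter (\<lambda>x. x \<noteq> Suc n) (ins (w, p)) = w"
      "length (takeWhile (\<lambda>x. x \<noteq> Suc n) (ins (w, p))) = p" if "(w, p) \<in> ?A" for w p
    proof -
      have w: "w \<in> stirling_perms n" and p: "p \<le> 2 * n"
        using that by (auto simp: unlucky_stirling_perms_def)
      have "Suc n \<notin> set w"
        using stirling_perms_set[OF w] by simp
      then have "\<forall>x\<in>set (take p w). x \<noteq> Suc n" "\<forall>x\<in>set (drop p w). x \<noteq> Suc n"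
        by (auto dest: in_set_takeD in_set_dropD)
      then show "filter (\<lambda>x. x \<noteq> Suc n) (ins (w, p)) = w"
        "length (takeWhile (\<lambda>x. x \<noteq> Suc n) (ins (w, p))) = p"
        using p stirling_perms_length[OF w]
        by (simp_all add: ins_def takeWhile_append2)
    qed
    then show "inj_on ins ?A"
      by (intro inj_onI) (metis prod.collapse)
    show "ins ` ?A = unlucky_stirling_perms (Suc n)"
    proof safe
      fix w p assume "w \<in> unlucky_stirling_perms n" "p \<in> {Suc n..2 * n}"
      moreover from this have "length w = 2 * n"
        using stirling_perms_length by (simp add: unlucky_stirling_perms_def)
      ultimately show "ins (w, p) \<in> unlucky_stirling_perms (Suc n)"
        by (simp add: ins_def unlucky_stirling_perms_insert_iff[OF assms])
    next
      fix w assume w: "w \<in> unlucky_stirling_perms (Suc n)"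
      then have "w \<in> stirling_perms (Suc n)"
        by (simp add: unlucky_stirling_perms_def)
      then obtain xs zs where eq: "w = xs @ Suc n # Suc n # zs"
        by (rule stirling_perms_Suc_split)
      with w have v: "xs @ zs \<in> unlucky_stirling_perms n" "length xs \<ge> Suc n"
        by (simp_all add: unlucky_stirling_perms_insert_iff[OF assms])
      \<comment> \<open>This gives \<open>length xs \<le> 2 * n\<close>, the upper limit for
        \<open>p\<close>.\<close>
      then have "length (xs @ zs) = 2 * n"
        by (intro stirling_perms_length) (simp add: unlucky_stirling_perms_def)
      with v show "w \<in> ins ` ?A"
        by (intro image_eqI[of _ _ "(xs @ zs, length xs)"]) (simp_all add: ins_def eq)
    qed
  qed
  then have "card (unlucky_stirling_perms (Suc n)) = card ?A"
    by (simp add: bij_betw_same_card)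
  then show ?thesis
    by (simp add: card_cartesian_product)
qed

lemma unlucky_stirling_perms_1: "unlucky_stirling_perms 1 = {[1, 1]}"
proof -
  have "w = [1, 1]" if "w \<in> stirling_perms 1" for w
  proof -
    \<comment> \<open>The split is used with \<open>n = 0\<close>; total length 2 leaves
      \<open>xs\<close> and \<open>zs\<close> empty.\<close>
    from that have "w \<in> stirling_perms (Suc 0)" by simp
    then obtain xs zs where "w = xs @ Suc 0 # Suc 0 # zs"
      by (rule stirling_perms_Suc_split)
    with stirling_perms_length[OF that] show ?thesis by simp
  qed
  moreover have "[1, 1] \<in> stirling_perms 1"
    by (simp add: stirling_perms_def)
  ultimately have eq: "stirling_perms 1 = {[1, 1]}"
    by blast
  have "w \<in> unlucky_stirling_perms 1 \<longleftrightarrow> w = [1, 1]" for w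
    unfolding unlucky_stirling_perms_def eq by (auto simp: nth_Cons')
  then show ?thesis
    by blast
qed

theorem theorem2p9:
  fixes n :: nat
  assumes "n \<ge> 1"
  shows "card {w \<in> stirling_perms n. extremely_unlucky w} = fact (n - 1)"
proof -
  have "card (unlucky_stirling_perms n) = fact (n - 1)"
    using assms
  proof (induction n rule: dec_induct)
    case base
    show ?case
      by (simp add: unlucky_stirling_perms_1[simplified])
  next
    \<comment> \<open>The factor \<open>n\<close> turns \<open>fact (n - 1)\<close> into
      \<open>fact n\<close>, as \<open>n \<ge> 1\<close>.\<close>
    case (step n)
    then show ?case
      by (simp add: card_unlucky_stirling_perms_Suc fact_reduce)
  qed
  then show ?thesis
    by (simp only: unlucky_stirling_perms_eq[OF assms])
qed

end
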